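(* Let $A$ be a $(\mathbb{Z}_2)^n$-graded commutative algebra, $p=2^n$, and $\mathbf{r}=(r_1,\dots,r_p)\in\mathbb{N}^p$. There exists a unique (up to multiplication by a scalar of weight $0$, i.e. by an element of $A^0$) $A$-linear graded Lie algebra homomorphism $$\Gamma\mathrm{tr}:\mathsf{M}(\mathbf{r};A)\to A$$ (homomorphisms being understood to be of weight $0$), and it is defined for a homogeneous matrix $X$ of degree $x$ by $$\Gamma\mathrm{tr}(X)=\sum_{k=1}^{p}(-1)^{\langle\gamma_k+x,\,\gamma_k\rangle}\,\mathrm{tr}(X_{kk}),$$ where $\mathrm{tr}$ is the usual trace and $X_{kk}$ is the $k$-th diagonal block of $X$.
   Context: The group $(\mathbb{Z}_2)^n$ carries the $\mathbb{Z}_2$-valued scalar product $\langle\gamma,\gamma'\rangle=\sum_i\gamma_i\gamma'_i$. Its elements $\gamma_1,\dots,\gamma_{p}$, $p=2^n$, are listed in a fixed order in which the elements with $\langle\gamma,\gamma\rangle=0$ (even) come first and those with $\langle\gamma,\gamma\rangle=1$ (odd) come last. A $(\mathbb{Z}_2)^n$-graded commutative algebra is an associative unital algebra $A=\bigoplus_\gamma A^\gamma$ over a field $\mathbb{K}$ of characteristic $0$ with $A^\gamma A^\delta\subset A^{\gamma+\delta}$ and $ba=(-1)^{\langle\tilde a,\tilde b\rangle}ab$ for homogeneous $a\in A^{\tilde a}$, $b\in A^{\tilde b}$. For $x\in(\mathbb{Z}_2)^n$, $\mathsf{M}^x(\mathbf{r};A)$ is the space of homogeneous matrices of degree $x$: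 $p\times p$ block matrices $X=(X_{ku})$ whose block $X_{ku}$ has size $r_k\times r_u$ and entries in $A^{\gamma_k+\gamma_u+x}$. $\mathsf{M}(\mathbf{r};A)=\bigoplus_x\mathsf{M}^x(\mathbf{r};A)$. It is a graded associative algebra under the usual matrix product, and a graded $A$-module under the action: for homogeneous $a\in A$, $aX$ is the matrix with blocks $(aX)_{ku}=(-1)^{\langle\tilde a,\gamma_k\rangle}a\,X_{ku}$. It is a graded Lie algebra with bracket $[X,Y]=XY-(-1)^{\langle x,y\rangle}YX$ for $X,Y$ homogeneous of degrees $x,y$ (extended bilinearly). $A$ is viewed as a graded module over itself and as a graded Lie algebra with the analogous graded commutator (which vanishes identically by graded commutativity). A map has weight $0$ if it sends degree-$x$ elements to degree-$x$ elements for all $x$. *)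

theory Defs
  imports "Jordan_Normal_Form.Matrix" "HOL-Library.Z2" "HOL-Library.FuncSet"
begin

(* The group (Z_2)^n is the set carrier_vec n of vectors of type bit vec, with the addition and
   the scalar product of the vector library. Components of a grading outside carrier_vec n are
   never used. *)

lemma finite_carrier_vec_bit: "finite (carrier_vec n :: bit vec set)"
proof -
  have "finite (UNIV :: bit set)"
    by (rule finite_subset[of _ "{0, 1}"]) auto
  then have "finite {xs :: bit list. set xs \<subseteq> UNIV \<and> length xs = n}"
    by (rule finite_lists_length_eq)
  moreover have "carrier_vec n \<subseteq> vec_of_list ` {xs :: bit list. set xs \<subseteq> UNIV \<and> length xs = n}"
  proof
    fix v :: "bit vec" assume "v \<in> carrier_vec n"
    then have "v = vec_of_list (list_of_vec v)" "length (list_of_vec v) = n"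
      by (auto simp: vec_list)
    then show "v \<in> vec_of_list ` {xs :: bit list. set xs \<subseteq> UNIV \<and> length xs = n}"
      by blast
  qed
  ultimately show ?thesis
    by (meson finite_imageI finite_subset)
qed

definition even_first_enumeration :: "nat \<Rightarrow> (nat \<Rightarrow> bit vec) \<Rightarrow> bool" where
  "even_first_enumeration n \<gamma> \<longleftrightarrow>
     bij_betw \<gamma> {..<2 ^ n} (carrier_vec n) \<and>
     (\<forall>k < 2 ^ n. \<forall>l < 2 ^ n. \<gamma> k \<bullet> \<gamma> k = 0 \<and> \<gamma> l \<bullet> \<gamma> l = 1 \<longrightarrow> k < l)"

definition bit_sign :: "bit \<Rightarrow> 'a::{ring, monoid_mult}" where
  "bit_sign b = (if b = 0 then 1 else - 1)"

(* The sort {ring, monoid_mult} is that of associative unital rings; unlike ring_1 it does not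
   exclude the zero ring. *)

locale graded_commutative_algebra = vector_space scale
  for scale :: "'k::field_char_0 \<Rightarrow> 'a::{ring, monoid_mult} \<Rightarrow> 'a" +
  fixes n :: nat and A :: "bit vec \<Rightarrow> 'a set"
  assumes scale_mult_left: "scale c (a * b) = scale c a * b"
    and scale_mult_right: "scale c (a * b) = a * scale c b"
    and subspace_component: "x \<in> carrier_vec n \<Longrightarrow> subspace (A x)"
    and direct_sum: "\<exists>!c. c \<in> (\<Pi>\<^sub>E x\<in>carrier_vec n. A x) \<and> a = (\<Sum>x\<in>carrier_vec n. c x)"
    and mult_component: "\<lbrakk>x \<in> carrier_vec n; y \<in> carrier_vec n; a \<in> A x; b \<in> A y\<rbrakk>
      \<Longrightarrow> a * b \<in> A (x + y)"
    and graded_commutative: "\<lbrakk>x \<in> carrier_vec n; y \<in> carrier_vec n; a \<in> A x; b \<in> A y\<rbrakk>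
      \<Longrightarrow> b * a = bit_sign (x \<bullet> y) * (a * b)"

definition component :: "nat \<Rightarrow> (bit vec \<Rightarrow> 'a::ab_group_add set) \<Rightarrow> bit vec \<Rightarrow> 'a \<Rightarrow> 'a" where
  "component n A x a =
     (THE c. c \<in> (\<Pi>\<^sub>E x\<in>carrier_vec n. A x) \<and> a = (\<Sum>x\<in>carrier_vec n. c x)) x"

definition alg_bracket ::
    "nat \<Rightarrow> (bit vec \<Rightarrow> 'a::{ring, monoid_mult} set) \<Rightarrow> 'a \<Rightarrow> 'a \<Rightarrow> 'a" where
  "alg_bracket n A a b =
     (\<Sum>x\<in>carrier_vec n. \<Sum>y\<in>carrier_vec n.
        component n A x a * component n A y b
        - bit_sign (x \<bullet> y) * (component n A y b * component n A x a))"

(* A p x p block matrix with block sizes r_k x r_u is stored as one square matrix of dimension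
   sum r {..<p}. Block indices run from 0 to p - 1, where p = 2 ^ n. *)

definition total_dim :: "nat \<Rightarrow> (nat \<Rightarrow> nat) \<Rightarrow> nat" where
  "total_dim n r = sum r {..<2 ^ n}"

definition block :: "(nat \<Rightarrow> nat) \<Rightarrow> 'a mat \<Rightarrow> nat \<Rightarrow> nat \<Rightarrow> 'a mat" where
  "block r X k u = mat (r k) (r u) (\<lambda>(i, j). X $$ (sum r {..<k} + i, sum r {..<u} + j))"

(* the block containing row (or column) i of the full matrix *)
definition block_index :: "(nat \<Rightarrow> nat) \<Rightarrow> nat \<Rightarrow> nat" where
  "block_index r i = (LEAST k. i < sum r {..k})"

definition mat_trace :: "'a::comm_monoid_add mat \<Rightarrow> 'a" where
  "mat_trace X = (\<Sum>i<dim_row X. X $$ (i, i))"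

definition homogeneous_mats ::
    "nat \<Rightarrow> (nat \<Rightarrow> bit vec) \<Rightarrow> (nat \<Rightarrow> nat) \<Rightarrow> (bit vec \<Rightarrow> 'a set) \<Rightarrow> bit vec \<Rightarrow> 'a mat set" where
  "homogeneous_mats n \<gamma> r A x =
     {X \<in> carrier_mat (total_dim n r) (total_dim n r).
        \<forall>k < 2 ^ n. \<forall>u < 2 ^ n. elements_mat (block r X k u) \<subseteq> A (\<gamma> k + \<gamma> u + x)}"

definition mat_sum :: "nat \<Rightarrow> ('i \<Rightarrow> 'a::comm_monoid_add mat) \<Rightarrow> 'i set \<Rightarrow> 'a mat" where
  "mat_sum N F S = mat N N (\<lambda>ij. \<Sum>s\<in>S. F s $$ ij)"

definition graded_mats ::
    "nat \<Rightarrow> (nat \<Rightarrow> bit vec) \<Rightarrow> (nat \<Rightarrow> nat) \<Rightarrow> (bit vec \<Rightarrow> 'a::comm_monoid_add set) \<Rightarrow> 'a mat set" where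
  "graded_mats n \<gamma> r A =
     {mat_sum (total_dim n r) Y (carrier_vec n) | Y.
        \<forall>x\<in>carrier_vec n. Y x \<in> homogeneous_mats n \<gamma> r A x}"

(* A matrix has degree x iff its entries in block (k, u) have degree gamma_k + gamma_u + x, so its
   homogeneous components are obtained by projecting the entries. *)
definition mat_component ::
    "nat \<Rightarrow> (nat \<Rightarrow> bit vec) \<Rightarrow> (nat \<Rightarrow> nat) \<Rightarrow> (bit vec \<Rightarrow> 'a::ab_group_add set)
      \<Rightarrow> bit vec \<Rightarrow> 'a mat \<Rightarrow> 'a mat" where
  "mat_component n \<gamma> r A x X =
     mat (total_dim n r) (total_dim n r)
       (\<lambda>(i, j). component n A (\<gamma> (block_index r i) + \<gamma> (block_index r j) + x) (X $$ (i, j)))"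

(* bilinear extension of [X, Y] = X Y - (-1)^<x,y> Y X for X, Y of degrees x, y *)
definition mat_bracket ::
    "nat \<Rightarrow> (nat \<Rightarrow> bit vec) \<Rightarrow> (nat \<Rightarrow> nat) \<Rightarrow> (bit vec \<Rightarrow> 'a::{ring, monoid_mult} set)
      \<Rightarrow> 'a mat \<Rightarrow> 'a mat \<Rightarrow> 'a mat" where
  "mat_bracket n \<gamma> r A X Y =
     mat_sum (total_dim n r)
       (\<lambda>(x, y). mat_component n \<gamma> r A x X * mat_component n \<gamma> r A y Y
          - bit_sign (x \<bullet> y) \<cdot>\<^sub>m (mat_component n \<gamma> r A y Y * mat_component n \<gamma> r A x X))
       (carrier_vec n \<times> carrier_vec n)"

(* additive extension in a of the action with blocks (-1)^<a,gamma_k> a X_ku for homogeneous a *)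
definition mat_action ::
    "nat \<Rightarrow> (nat \<Rightarrow> bit vec) \<Rightarrow> (nat \<Rightarrow> nat) \<Rightarrow> (bit vec \<Rightarrow> 'a::{ring, monoid_mult} set)
      \<Rightarrow> 'a \<Rightarrow> 'a mat \<Rightarrow> 'a mat" where
  "mat_action n \<gamma> r A a X =
     mat (total_dim n r) (total_dim n r)
       (\<lambda>(i, j). \<Sum>y\<in>carrier_vec n.
          bit_sign (y \<bullet> \<gamma> (block_index r i)) * component n A y a * X $$ (i, j))"

definition graded_lie_algebra_hom ::
    "('k \<Rightarrow> 'a \<Rightarrow> 'a) \<Rightarrow> nat \<Rightarrow> (nat \<Rightarrow> bit vec) \<Rightarrow> (nat \<Rightarrow> nat)
      \<Rightarrow> (bit vec \<Rightarrow> 'a::{ring, monoid_mult} set) \<Rightarrow> ('a mat \<Rightarrow> 'a) \<Rightarrow> bool" where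
  "graded_lie_algebra_hom scale n \<gamma> r A f \<longleftrightarrow>
     (\<forall>X\<in>graded_mats n \<gamma> r A. \<forall>Y\<in>graded_mats n \<gamma> r A. f (X + Y) = f X + f Y) \<and>
     (\<forall>c. \<forall>X\<in>graded_mats n \<gamma> r A. f (map_mat (scale c) X) = scale c (f X)) \<and>
     (\<forall>x\<in>carrier_vec n. \<forall>X\<in>homogeneous_mats n \<gamma> r A x. f X \<in> A x) \<and>
     (\<forall>X\<in>graded_mats n \<gamma> r A. \<forall>Y\<in>graded_mats n \<gamma> r A.
        f (mat_bracket n \<gamma> r A X Y) = alg_bracket n A (f X) (f Y))"

definition algebra_linear ::
    "nat \<Rightarrow> (nat \<Rightarrow> bit vec) \<Rightarrow> (nat \<Rightarrow> nat)
      \<Rightarrow> (bit vec \<Rightarrow> 'a::{ring, monoid_mult} set) \<Rightarrow> ('a mat \<Rightarrow> 'a) \<Rightarrow> bool" where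
  "algebra_linear n \<gamma> r A f \<longleftrightarrow>
     (\<forall>X\<in>graded_mats n \<gamma> r A. \<forall>Y\<in>graded_mats n \<gamma> r A. f (X + Y) = f X + f Y) \<and>
     (\<forall>a. \<forall>X\<in>graded_mats n \<gamma> r A. f (mat_action n \<gamma> r A a X) = a * f X)"

end

theory Submission
  imports Defs
begin

text \<open>
  Number the rows of a block matrix by \<open>i\<close> and give row \<open>i\<close> the degree \<open>g\<^sub>i = \<gamma> k\<close> of the block
  \<open>k\<close> that contains it. A matrix has degree \<open>x\<close> iff its entry at \<open>(i, j)\<close> has degree
  \<open>g\<^sub>i + g\<^sub>j + x\<close>.

  For a degree \<open>g\<close> the map that multiplies the degree \<open>y\<close> part of an element by
  \<open>(-1)^\<langle>y, g\<rangle>\<close>, called the twist by \<open>g\<close>, is an involutive ring automorphism of \<open>A\<close>.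
  Acting by \<open>a\<close> on a matrix multiplies row \<open>i\<close> by the twist of \<open>a\<close> by \<open>g\<^sub>i\<close>, and the sum
  of the block traces with signs becomes
  \<open>\<Sum>\<^sub>i (-1)^\<langle>g\<^sub>i, g\<^sub>i\<rangle> twist g\<^sub>i X\<^sub>i\<^sub>i\<close>, an expression that makes
  sense for inhomogeneous matrices too. It is linear over \<open>A\<close> because the twist is
  multiplicative and involutive.

  All graded commutators in \<open>A\<close> vanish, so a linear map to \<open>A\<close> respects brackets iff it
  vanishes on brackets. The graded trace does because \<open>Gtr(XY) = (-1)^\<langle>x, y\<rangle> Gtr(YX)\<close> for \<open>X\<close>, \<open>Y\<close> of
  degrees \<open>x\<close>, \<open>y\<close>: commuting \<open>X\<^sub>i\<^sub>j\<close> past \<open>Y\<^sub>j\<^sub>i\<close> produces a sign, and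
  \<open>trace_sign_identity\<close> says that it is exactly the quotient of the other signs involved.

  For uniqueness, let \<open>f\<close> be another such map. The matrix units \<open>E\<^sub>i\<^sub>j\<close> are homogeneous
  and generate the matrices over \<open>A\<close>, so \<open>f\<close> is known once its values on them are. For
  \<open>i \<noteq> j\<close>, \<open>[E\<^sub>i\<^sub>j, E\<^sub>j\<^sub>j] = E\<^sub>i\<^sub>j\<close> forces \<open>f(E\<^sub>i\<^sub>j) = 0\<close>, and the bracket of
  \<open>E\<^sub>i\<^sub>j\<close> with \<open>E\<^sub>j\<^sub>i\<close> forces \<open>(-1)^\<langle>g\<^sub>i, g\<^sub>i\<rangle> f(E\<^sub>i\<^sub>i)\<close> to be the same for all
  \<open>i\<close>. This common value is the scalar: it has degree 0 because \<open>E\<^sub>i\<^sub>i\<close> has.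
\<close>

section \<open>Signs and vectors over the two-element field\<close>

lemma bit_sign_0 [simp]: "bit_sign 0 = 1"
  by (simp add: bit_sign_def)

lemma bit_sign_add: "bit_sign (a + b) = bit_sign a * bit_sign b"
  by (cases a; cases b) (simp_all add: bit_sign_def)

lemma bit_sign_self [simp]: "bit_sign a * bit_sign a = 1"
  by (simp add: bit_sign_def)

lemma bit_sign_self_left [simp]: "bit_sign a * (bit_sign a * z) = z"
  by (simp flip: mult.assoc)

lemma bit_sign_left_commute: "z * (bit_sign a * w) = bit_sign a * (z * w)"
  by (simp add: bit_sign_def)

lemma bit_vec_add_self:
  fixes x :: "bit vec"
  assumes "x \<in> carrier_vec n"
  shows "x + x = 0\<^sub>v n"
  using assms by (intro eq_vecI) auto

lemma bit_vec_add_cancel: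
  fixes x y :: "bit vec"
  assumes "x \<in> carrier_vec n" "y \<in> carrier_vec n"
  shows "x + (x + y) = y"
proof -
  have "x + (x + y) = (x + x) + y"
    using assms by (metis assoc_add_vec)
  also have "\<dots> = y"
    unfolding bit_vec_add_self[OF assms(1)] using assms(2) by (rule left_zero_vec)
  finally show ?thesis .
qed

lemma scalar_prod_self_add:
  fixes g h :: "bit vec"
  assumes "g \<in> carrier_vec n" "h \<in> carrier_vec n"
  shows "(g + h) \<bullet> (g + h) = g \<bullet> g + h \<bullet> h"
proof -
  have "(g + h) \<bullet> (g + h) = (g \<bullet> g + g \<bullet> h) + (h \<bullet> g + h \<bullet> h)"
    using assms by (simp only: add_scalar_prod_distrib scalar_prod_add_distrib add_carrier_vec)
  moreover have "h \<bullet> g = g \<bullet> h"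
    using assms comm_scalar_prod by blast
  moreover have "(gg + gh) + (gh + hh) = gg + hh" for gg gh hh :: bit
    by (cases gg; cases gh; cases hh) simp_all
  ultimately show ?thesis
    by (simp only:)
qed

text \<open>The signs met when \<open>X\<^sub>i\<^sub>j Y\<^sub>j\<^sub>i\<close> is compared with \<open>Y\<^sub>j\<^sub>i X\<^sub>i\<^sub>j\<close>, for rows of degrees
  \<open>g\<close> and \<open>h\<close> and matrices of degrees \<open>x\<close> and \<open>y\<close>. In order: the sign of the graded trace in
  the row of degree \<open>g\<close>, the sign of the bracket, the sign of the graded trace in the row of
  degree \<open>h\<close>, and the sign of commuting the two entries. Expanding the last product, every
  term except \<open>\<langle>g, g + x + y\<rangle>\<close> occurs an even number of times.\<close>

lemma trace_sign_identity:
  fixes g h x y :: "bit vec"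
  assumes "g \<in> carrier_vec n" "h \<in> carrier_vec n" "x \<in> carrier_vec n" "y \<in> carrier_vec n"
  shows "(g + (x + y)) \<bullet> g =
    x \<bullet> y + ((h + (x + y)) \<bullet> h + (g + h + x) \<bullet> (h + g + y))"
proof -
  have comm: "h \<bullet> g = g \<bullet> h" "x \<bullet> g = g \<bullet> x" "x \<bullet> h = h \<bullet> x"
      "y \<bullet> g = g \<bullet> y" "y \<bullet> h = h \<bullet> y"
    using assms comm_scalar_prod by blast+
  \<comment> \<open>The expanded identity, with one variable for each scalar product of two vectors.\<close>
  have bits: "gg + (gx + gy) =
      xy + ((hh + (hx + hy)) + (gh + hh + hx + (gg + gh + gx) + (gy + hy + xy)))"
    for gg gx gy xy hh hx hy gh :: bit
    by (cases gg; cases gx; cases gy; cases xy; cases hh; cases hx; cases hy; cases gh) simp_all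
  have l: "(u + v) \<bullet> w = u \<bullet> w + v \<bullet> w" and r: "w \<bullet> (u + v) = w \<bullet> u + w \<bullet> v"
    if "u \<in> carrier_vec n" "v \<in> carrier_vec n" "w \<in> carrier_vec n" for u v w :: "bit vec"
    using that by (simp_all only: add_scalar_prod_distrib scalar_prod_add_distrib)
  show ?thesis
    using bits by (simp only: l r assms add_carrier_vec comm)
qed

lemma bit_vec_shift_bij:
  fixes x :: "bit vec"
  assumes "x \<in> carrier_vec n"
  shows "bij_betw (\<lambda>y. x + y) (carrier_vec n) (carrier_vec n)"
  by (rule bij_betwI[where g = "\<lambda>y. x + y"])
    (auto simp: bit_vec_add_cancel[OF assms] intro: add_carrier_vec[OF assms])

section \<open>Homogeneous components of algebra elements\<close>

context graded_commutative_algebra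
begin

abbreviation part where "part \<equiv> component n A"

lemma component_decomposition:
  shows component_in: "x \<in> carrier_vec n \<Longrightarrow> part x a \<in> A x"
    and sum_component: "(\<Sum>x\<in>carrier_vec n. part x a) = a"
proof -
  have "(THE c. c \<in> (\<Pi>\<^sub>E x\<in>carrier_vec n. A x) \<and> a = (\<Sum>x\<in>carrier_vec n. c x))
      \<in> (\<Pi>\<^sub>E x\<in>carrier_vec n. A x) \<and>
    a = (\<Sum>x\<in>carrier_vec n. (THE c. c \<in> (\<Pi>\<^sub>E x\<in>carrier_vec n. A x) \<and>
      a = (\<Sum>x\<in>carrier_vec n. c x)) x)"
    by (rule theI'[OF direct_sum])
  then show "x \<in> carrier_vec n \<Longrightarrow> part x a \<in> A x" "(\<Sum>x\<in>carrier_vec n. part x a) = a"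
    unfolding component_def by auto
qed

lemma component_unique:
  assumes "\<And>x. x \<in> carrier_vec n \<Longrightarrow> c x \<in> A x" "(\<Sum>x\<in>carrier_vec n. c x) = a"
    and "x \<in> carrier_vec n"
  shows "part x a = c x"
proof -
  let ?P = "\<lambda>c. c \<in> (\<Pi>\<^sub>E x\<in>carrier_vec n. A x) \<and> a = (\<Sum>x\<in>carrier_vec n. c x)"
  have "?P (restrict c (carrier_vec n))"
    using assms by auto
  then have "The ?P = restrict c (carrier_vec n)"
    by (rule the1_equality[OF direct_sum])
  with assms(3) show ?thesis
    by (simp add: component_def)
qed

lemma zero_in: "x \<in> carrier_vec n \<Longrightarrow> 0 \<in> A x"
  using subspace_0 subspace_component by blast

lemma add_in: "x \<in> carrier_vec n \<Longrightarrow> a \<in> A x \<Longrightarrow> b \<in> A x \<Longrightarrow> a + b \<in> A x"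
  using subspace_add subspace_component by blast

lemma scale_in: "x \<in> carrier_vec n \<Longrightarrow> a \<in> A x \<Longrightarrow> scale c a \<in> A x"
  using subspace_scale subspace_component by blast

lemma sum_in: "x \<in> carrier_vec n \<Longrightarrow> (\<And>i. i \<in> I \<Longrightarrow> h i \<in> A x) \<Longrightarrow> sum h I \<in> A x"
  using subspace_sum subspace_component by blast

lemma bit_sign_in: "x \<in> carrier_vec n \<Longrightarrow> a \<in> A x \<Longrightarrow> bit_sign b * a \<in> A x"
  using subspace_neg subspace_component by (auto simp: bit_sign_def)

lemma component_add: "x \<in> carrier_vec n \<Longrightarrow> part x (a + b) = part x a + part x b"
  by (rule component_unique) (auto intro: add_in component_in simp: sum.distrib sum_component)

lemma component_scale: "x \<in> carrier_vec n \<Longrightarrow> part x (scale c a) = scale c (part x a)"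
  by (rule component_unique)
    (auto intro: scale_in component_in simp: sum_component simp flip: scale_sum_right)

lemma component_homogeneous:
  assumes "a \<in> A y" "x \<in> carrier_vec n" "y \<in> carrier_vec n"
  shows "part x a = (if x = y then a else 0)"
  by (rule component_unique) (use assms finite_carrier_vec_bit zero_in in auto)

lemma component_0 [simp]: "x \<in> carrier_vec n \<Longrightarrow> part x 0 = 0"
  using component_homogeneous[of 0 x x] zero_in by simp

text \<open>The degree 0 part \<open>e\<close> of \<open>1\<close> is a right unit: for \<open>a\<close> of degree \<open>y\<close>, comparing the degree
  \<open>y\<close> parts of \<open>a = a 1\<close> gives \<open>a = a e\<close>. Hence \<open>e = 1 e = 1\<close>.\<close>

lemma one_in: "1 \<in> A (0\<^sub>v n)"
proof -
  define e where "e = part (0\<^sub>v n) 1"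
  have homogeneous: "a * e = a" if a: "a \<in> A y" and y: "y \<in> carrier_vec n" for a y
  proof -
    \<comment> \<open>Shifting the index by \<open>y\<close> makes the \<open>x\<close>-th summand homogeneous of degree \<open>x\<close>.\<close>
    have "(\<Sum>x\<in>carrier_vec n. a * part (y + x) 1) = (\<Sum>x\<in>carrier_vec n. a * part x 1)"
      by (rule sum.reindex_bij_betw[OF bit_vec_shift_bij[OF y]])
    also have "\<dots> = a"
      by (simp add: sum_component flip: sum_distrib_left)
    finally have "(\<Sum>x\<in>carrier_vec n. a * part (y + x) 1) = a" .
    moreover have "a * part (y + x) 1 \<in> A x" if "x \<in> carrier_vec n" for x
      using mult_component[of y "y + x" a "part (y + x) 1"] that a y component_in
      by (simp add: bit_vec_add_cancel)
    ultimately have "part y a = a * part (y + y) 1"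
      using y by (intro component_unique) auto
    with a y show ?thesis
      by (simp add: component_homogeneous bit_vec_add_self e_def)
  qed
  have "e = (\<Sum>x\<in>carrier_vec n. part x 1) * e"
    by (simp add: sum_component)
  also have "\<dots> = (\<Sum>x\<in>carrier_vec n. part x 1)"
    unfolding sum_distrib_right using component_in by (intro sum.cong homogeneous) auto
  finally have "e = 1"
    by (simp add: sum_component)
  then show ?thesis
    using component_in[of "0\<^sub>v n" 1] by (simp add: e_def)
qed

lemma degree_0_central:
  assumes "c \<in> A (0\<^sub>v n)"
  shows "a * c = c * a"
proof -
  have "part x a * c = c * part x a" if "x \<in> carrier_vec n" for x
    using graded_commutative[OF that zero_carrier_vec component_in[OF that, of a] assms] that
    by simp
  then have "(\<Sum>x\<in>carrier_vec n. part x a) * c = c * (\<Sum>x\<in>carrier_vec n. part x a)"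
    by (simp add: sum_distrib_left sum_distrib_right)
  then show ?thesis
    by (simp add: sum_component)
qed

lemma alg_bracket_eq_0: "alg_bracket n A a b = 0"
proof -
  have "part x a * part y b - bit_sign (x \<bullet> y) * (part y b * part x a) = 0"
    if "x \<in> carrier_vec n" "y \<in> carrier_vec n" for x y
    by (simp add: graded_commutative[OF that component_in[OF that(1)] component_in[OF that(2)]])
  then show ?thesis
    by (simp add: alg_bracket_def)
qed

section \<open>The twist of the algebra by a degree\<close>

text \<open>The action of the character \<open>y \<mapsto> (-1)^\<langle>y, g\<rangle>\<close> of the grading group. The factors in the
  action of an element on row \<open>i\<close> of a matrix, and the signs in the graded trace that depend
  on the degree of the matrix, are both of this form.\<close>

definition twist :: "bit vec \<Rightarrow> 'a \<Rightarrow> 'a" where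
  "twist g a = (\<Sum>y\<in>carrier_vec n. bit_sign (y \<bullet> g) * part y a)"

lemma twist_homogeneous:
  assumes "a \<in> A x" "x \<in> carrier_vec n"
  shows "twist g a = bit_sign (x \<bullet> g) * a"
proof -
  have "twist g a = (\<Sum>y\<in>carrier_vec n. if y = x then bit_sign (y \<bullet> g) * a else 0)"
    unfolding twist_def using assms by (intro sum.cong) (auto simp: component_homogeneous)
  then show ?thesis
    using assms finite_carrier_vec_bit by simp
qed

lemma twist_add: "twist g (a + b) = twist g a + twist g b"
  by (simp add: twist_def component_add distrib_left sum.distrib)

lemma twist_0 [simp]: "twist g 0 = 0"
  by (simp add: twist_def)

lemma twist_1 [simp]: "g \<in> carrier_vec n \<Longrightarrow> twist g 1 = 1"
  by (simp add: twist_homogeneous[OF one_in])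

lemma twist_sum: "twist g (sum h I) = (\<Sum>i\<in>I. twist g (h i))"
  by (induction I rule: infinite_finite_induct) (simp_all add: twist_add)

lemma twist_scale: "twist g (scale c a) = scale c (twist g a)"
  by (simp add: twist_def component_scale scale_sum_right scale_mult_right)

text \<open>The sign \<open>(-1)^\<langle>y, g\<rangle>\<close> is a character in \<open>y\<close>, and degrees add under multiplication.\<close>

lemma twist_mult:
  assumes g: "g \<in> carrier_vec n"
  shows "twist g (a * b) = twist g a * twist g b"
proof -
  have "twist g (part x a * part y b) =
      (bit_sign (x \<bullet> g) * part x a) * (bit_sign (y \<bullet> g) * part y b)"
    if "x \<in> carrier_vec n" "y \<in> carrier_vec n" for x y
  proof -
    have "twist g (part x a * part y b) =
        bit_sign ((x + y) \<bullet> g) * (part x a * part y b)"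
      using that component_in by (intro twist_homogeneous mult_component) auto
    also have "(x + y) \<bullet> g = x \<bullet> g + y \<bullet> g"
      using that g by (intro add_scalar_prod_distrib)
    finally show ?thesis
      by (simp only: bit_sign_add mult.assoc bit_sign_left_commute[of "part x a"])
  qed
  moreover have "a * b = (\<Sum>x\<in>carrier_vec n. \<Sum>y\<in>carrier_vec n. part x a * part y b)"
    by (simp add: sum_component flip: sum_product)
  ultimately show ?thesis
    by (simp add: twist_sum) (simp add: twist_def sum_product)
qed

lemma twist_twist [simp]: "twist g (twist g a) = a"
proof -
  have "twist g (bit_sign (x \<bullet> g) * part x a) = part x a" if "x \<in> carrier_vec n" for x
    using that component_in bit_sign_in by (subst twist_homogeneous[of _ x]) auto
  then show ?thesis
    by (simp add: twist_def[of g a] twist_sum sum_component)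
qed

end

section \<open>Rows and their blocks\<close>

lemma sum_blocks:
  fixes h :: "nat \<Rightarrow> 'b::comm_monoid_add" and r :: "nat \<Rightarrow> nat"
  shows "(\<Sum>k<p. \<Sum>i<r k. h (sum r {..<k} + i)) = (\<Sum>i<sum r {..<p}. h i)"
proof (induction p)
  case (Suc p)
  have "(\<Sum>i<m + l. h i) = (\<Sum>i<m. h i) + (\<Sum>i<l. h (m + i))" for m l :: nat
    by (induction l) (simp_all add: add.assoc)
  then show ?case
    by (simp add: Suc)
qed simp

lemma block_index_offset:
  fixes r :: "nat \<Rightarrow> nat"
  assumes "i < r k"
  shows "block_index r (sum r {..<k} + i) = k"
  unfolding block_index_def
proof (rule Least_equality)
  show "sum r {..<k} + i < sum r {..k}"
    using assms by (simp flip: lessThan_Suc_atMost)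
next
  fix l assume l: "sum r {..<k} + i < sum r {..l}"
  show "k \<le> l"
  proof (rule ccontr)
    assume "\<not> k \<le> l"
    then have "sum r {..l} \<le> sum r {..<k}"
      by (intro sum_mono2) auto
    with l show False by simp
  qed
qed

text \<open>Together with \<open>block_index_offset\<close> and \<open>offset_less_total\<close>, this identifies the rows with
  the pairs of a block and an offset in it, empty blocks being skipped.\<close>

lemma row_in_block:
  fixes r :: "nat \<Rightarrow> nat"
  assumes "i < sum r {..<p}"
  obtains k j where "k < p" "j < r k" "i = sum r {..<k} + j"
  using assms
proof (induction p arbitrary: thesis)
  case (Suc p)
  show ?case
  proof (cases "i < sum r {..<p}")
    case True
    with Suc show ?thesis
      by (metis less_SucI)
  next
    case False
    with Suc.prems(2) show ?thesis
      by (intro Suc.prems(1)[of p "i - sum r {..<p}"]) auto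
  qed
qed simp

lemma offset_less_total:
  fixes r :: "nat \<Rightarrow> nat"
  assumes "k < p" "i < r k"
  shows "sum r {..<k} + i < sum r {..<p}"
proof -
  have "sum r {..<k} + i < sum r {..<Suc k}"
    using assms by simp
  also have "\<dots> \<le> sum r {..<p}"
    using assms by (intro sum_mono2) auto
  finally show ?thesis .
qed

section \<open>Graded block matrices\<close>

lemma mat_sum_carrier [simp]: "mat_sum N F S \<in> carrier_mat N N"
  by (simp add: mat_sum_def)

lemma dim_mat_sum [simp]: "dim_row (mat_sum N F S) = N" "dim_col (mat_sum N F S) = N"
  by (simp_all add: mat_sum_def)

lemma index_mat_sum [simp]:
  "i < N \<Longrightarrow> j < N \<Longrightarrow> mat_sum N F S $$ (i, j) = (\<Sum>s\<in>S. F s $$ (i, j))"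
  by (simp add: mat_sum_def)

text \<open>Additivity determines the value at the zero matrix, so the empty sum is covered.\<close>

lemma additive_mat_sum:
  fixes f :: "'a::ab_group_add mat \<Rightarrow> 'b::ab_group_add"
  assumes add: "\<And>X Y. X \<in> carrier_mat N N \<Longrightarrow> Y \<in> carrier_mat N N \<Longrightarrow> f (X + Y) = f X + f Y"
    and "finite S" "\<And>s. s \<in> S \<Longrightarrow> F s \<in> carrier_mat N N"
  shows "f (mat_sum N F S) = (\<Sum>s\<in>S. f (F s))"
  using assms(2,3)
proof (induction S rule: finite_induct)
  case empty
  have "mat_sum N F {} = 0\<^sub>m N N"
    by (intro eq_matI) auto
  with add[of "0\<^sub>m N N" "0\<^sub>m N N"] show ?case
    by simp
next
  case (insert s S)
  have "mat_sum N F (insert s S) = F s + mat_sum N F S"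
    using insert by (intro eq_matI) auto
  with insert show ?case
    by (simp add: add)
qed

locale graded_block_matrices = graded_commutative_algebra scale n A
  for scale :: "'k::field_char_0 \<Rightarrow> 'a::{ring, monoid_mult} \<Rightarrow> 'a" and n A +
  fixes \<gamma> :: "nat \<Rightarrow> bit vec" and r :: "nat \<Rightarrow> nat"
  assumes degree_carrier: "k < 2 ^ n \<Longrightarrow> \<gamma> k \<in> carrier_vec n"
begin

abbreviation N where "N \<equiv> total_dim n r"

abbreviation deg :: "nat \<Rightarrow> bit vec" where "deg i \<equiv> \<gamma> (block_index r i)"

lemma deg_carrier [simp, intro]: "i < N \<Longrightarrow> deg i \<in> carrier_vec n"
  unfolding total_dim_def
  by (metis row_in_block block_index_offset degree_carrier)

text \<open>The passage from blocks to entries: every degree computation below is one about entries.\<close>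

lemma homogeneous_mats_iff:
  assumes x: "x \<in> carrier_vec n"
  shows "X \<in> homogeneous_mats n \<gamma> r A x \<longleftrightarrow>
    X \<in> carrier_mat N N \<and> (\<forall>i<N. \<forall>j<N. X $$ (i, j) \<in> A (deg i + deg j + x))"
proof -
  have "(\<forall>k<2 ^ n. \<forall>u<2 ^ n. elements_mat (block r X k u) \<subseteq> A (\<gamma> k + \<gamma> u + x)) \<longleftrightarrow>
      (\<forall>i<N. \<forall>j<N. X $$ (i, j) \<in> A (deg i + deg j + x))" (is "?L \<longleftrightarrow> ?R")
  proof
    assume L: ?L
    show ?R
    proof (intro allI impI)
      fix i j assume "i < N" "j < N"
      then obtain k i' u j' where "k < 2 ^ n" "i' < r k" "i = sum r {..<k} + i'"
        "u < 2 ^ n" "j' < r u" "j = sum r {..<u} + j'"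
        unfolding total_dim_def by (elim row_in_block)
      then show "X $$ (i, j) \<in> A (deg i + deg j + x)"
        using L[rule_format, of k u] elements_matI[of "block r X k u" "r k" "r u" i' j']
        by (auto simp: block_index_offset block_def)
    qed
  next
    assume R: ?R
    show ?L
    proof (intro allI impI subsetI)
      fix k u a
      assume ku: "k < 2 ^ n" "u < 2 ^ n" and "a \<in> elements_mat (block r X k u)"
      then obtain i j where ij: "i < r k" "j < r u"
        and a: "a = X $$ (sum r {..<k} + i, sum r {..<u} + j)"
        by (auto simp: block_def dest!: elements_matD)
      then show "a \<in> A (\<gamma> k + \<gamma> u + x)"
        using R[rule_format, of "sum r {..<k} + i" "sum r {..<u} + j"] ku
        by (simp add: block_index_offset total_dim_def offset_less_total)
    qed
  qed
  then show ?thesis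
    unfolding homogeneous_mats_def by simp
qed

lemma mat_component_homogeneous:
  "x \<in> carrier_vec n \<Longrightarrow> mat_component n \<gamma> r A x X \<in> homogeneous_mats n \<gamma> r A x"
  by (auto simp: homogeneous_mats_iff mat_component_def component_in)

lemma mat_component_carrier [simp]: "mat_component n \<gamma> r A x X \<in> carrier_mat N N"
  by (simp add: mat_component_def)

text \<open>The homogeneous components of a matrix add up to it, since for fixed \<open>(i, j)\<close> the degree
  \<open>g\<^sub>i + g\<^sub>j + x\<close> runs over the whole grading group with \<open>x\<close>.\<close>

lemma graded_mats_eq: "graded_mats n \<gamma> r A = carrier_mat N N"
proof
  show "graded_mats n \<gamma> r A \<subseteq> carrier_mat N N"
    by (auto simp: graded_mats_def)
  show "carrier_mat N N \<subseteq> graded_mats n \<gamma> r A"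
  proof
    fix X :: "'a mat" assume X: "X \<in> carrier_mat N N"
    have "X = mat_sum N (\<lambda>x. mat_component n \<gamma> r A x X) (carrier_vec n)"
    proof (rule eq_matI)
      fix i j assume "i < dim_row (mat_sum N (\<lambda>x. mat_component n \<gamma> r A x X) (carrier_vec n))"
        "j < dim_col (mat_sum N (\<lambda>x. mat_component n \<gamma> r A x X) (carrier_vec n))"
      then have ij: "i < N" "j < N" by auto
      have "(\<Sum>x\<in>carrier_vec n. part (deg i + deg j + x) (X $$ (i, j))) =
          (\<Sum>x\<in>carrier_vec n. part x (X $$ (i, j)))"
        using ij by (intro sum.reindex_bij_betw[OF bit_vec_shift_bij]) auto
      with ij show "X $$ (i, j) =
          mat_sum N (\<lambda>x. mat_component n \<gamma> r A x X) (carrier_vec n) $$ (i, j)"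
        by (simp add: mat_component_def sum_component)
    qed (use X in auto)
    then show "X \<in> graded_mats n \<gamma> r A"
      unfolding graded_mats_def using mat_component_homogeneous by blast
  qed
qed

lemma mat_component_of_homogeneous:
  assumes "X \<in> homogeneous_mats n \<gamma> r A y" "x \<in> carrier_vec n" "y \<in> carrier_vec n"
  shows "mat_component n \<gamma> r A x X = (if x = y then X else 0\<^sub>m N N)"
proof (rule eq_matI)
  fix i j
  assume "i < dim_row (if x = y then X else 0\<^sub>m N N)" "j < dim_col (if x = y then X else 0\<^sub>m N N)"
  moreover have X: "X \<in> carrier_mat N N"
    using assms by (simp add: homogeneous_mats_iff)
  ultimately have ij: "i < N" "j < N"
    by (auto split: if_splits)
  have "deg i + deg j + x = deg i + deg j + y \<longleftrightarrow> x = y"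
    using ij assms by (metis add_carrier_vec bit_vec_add_cancel deg_carrier)
  moreover have "X $$ (i, j) \<in> A (deg i + deg j + y)"
    using assms ij by (simp add: homogeneous_mats_iff)
  ultimately show "mat_component n \<gamma> r A x X $$ (i, j) = (if x = y then X else 0\<^sub>m N N) $$ (i, j)"
    using ij assms by (simp add: mat_component_def component_homogeneous)
qed (use assms in \<open>auto simp: homogeneous_mats_iff mat_component_def\<close>)

text \<open>Only one term of the double sum in the bilinear extension survives.\<close>

lemma mat_bracket_homogeneous:
  assumes X: "X \<in> homogeneous_mats n \<gamma> r A x" and x: "x \<in> carrier_vec n"
    and Y: "Y \<in> homogeneous_mats n \<gamma> r A y" and y: "y \<in> carrier_vec n"
  shows "mat_bracket n \<gamma> r A X Y = X * Y - bit_sign (x \<bullet> y) \<cdot>\<^sub>m (Y * X)"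
proof (rule eq_matI)
  have car: "X \<in> carrier_mat N N" "Y \<in> carrier_mat N N"
    using assms by (auto simp: homogeneous_mats_iff)
  fix i j
  assume "i < dim_row (X * Y - bit_sign (x \<bullet> y) \<cdot>\<^sub>m (Y * X))"
    "j < dim_col (X * Y - bit_sign (x \<bullet> y) \<cdot>\<^sub>m (Y * X))"
  with car have ij: "i < N" "j < N"
    by auto
  let ?F = "\<lambda>(u, v). mat_component n \<gamma> r A u X * mat_component n \<gamma> r A v Y
    - bit_sign (u \<bullet> v) \<cdot>\<^sub>m (mat_component n \<gamma> r A v Y * mat_component n \<gamma> r A u X)"
  have "?F p $$ (i, j) =
      (if p = (x, y) then (X * Y - bit_sign (x \<bullet> y) \<cdot>\<^sub>m (Y * X)) $$ (i, j) else 0)"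
    if p_in: "p \<in> carrier_vec n \<times> carrier_vec n" for p
  proof -
    obtain u v where p: "p = (u, v)" "u \<in> carrier_vec n" "v \<in> carrier_vec n"
      using p_in by blast
    show ?thesis
      using p ij car
      by (cases "u = x"; cases "v = y")
        (simp_all add: mat_component_of_homogeneous[OF X _ x] mat_component_of_homogeneous[OF Y _ y])
  qed
  then have "(\<Sum>p\<in>carrier_vec n \<times> carrier_vec n. ?F p $$ (i, j)) =
      (X * Y - bit_sign (x \<bullet> y) \<cdot>\<^sub>m (Y * X)) $$ (i, j)"
    using x y finite_carrier_vec_bit by (simp cong: sum.cong)
  then show "mat_bracket n \<gamma> r A X Y $$ (i, j) = (X * Y - bit_sign (x \<bullet> y) \<cdot>\<^sub>m (Y * X)) $$ (i, j)"
    using ij by (simp add: mat_bracket_def)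
qed (use assms in \<open>auto simp: homogeneous_mats_iff mat_bracket_def\<close>)

lemma mat_action_index:
  "i < N \<Longrightarrow> j < N \<Longrightarrow> mat_action n \<gamma> r A a X $$ (i, j) = twist (deg i) a * X $$ (i, j)"
  by (simp add: mat_action_def twist_def sum_distrib_right)

lemma mat_action_carrier [simp]: "mat_action n \<gamma> r A a X \<in> carrier_mat N N"
  by (simp add: mat_action_def)

text \<open>A sign has degree 0 and is therefore fixed by every twist, so multiplying a matrix by it is
  the same as acting by it.\<close>

lemma linear_diff_bit_sign:
  assumes add: "\<And>X Y. X \<in> carrier_mat N N \<Longrightarrow> Y \<in> carrier_mat N N \<Longrightarrow> f (X + Y) = f X + f Y"
    and act: "\<And>a X. X \<in> carrier_mat N N \<Longrightarrow> f (mat_action n \<gamma> r A a X) = a * (f X :: 'a)"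
    and U: "U \<in> carrier_mat N N" and V: "V \<in> carrier_mat N N"
  shows "f (U - bit_sign b \<cdot>\<^sub>m V) = f U - bit_sign b * f V"
proof -
  let ?s = "bit_sign b :: 'a"
  have "?s \<in> A (0\<^sub>v n)"
    using bit_sign_in[OF zero_carrier_vec one_in] by simp
  then have twist: "twist (deg i) ?s = ?s" if "i < N" for i
    using that by (simp add: twist_homogeneous[of _ "0\<^sub>v n"])
  have "U = (U - ?s \<cdot>\<^sub>m V) + mat_action n \<gamma> r A ?s V"
    using U V by (intro eq_matI) (auto simp: mat_action_index twist carrier_matD[OF mat_action_carrier])
  then have "f U = f (U - ?s \<cdot>\<^sub>m V) + f (mat_action n \<gamma> r A ?s V)"
    using add[of "U - ?s \<cdot>\<^sub>m V" "mat_action n \<gamma> r A ?s V"] V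
    by (simp add: minus_carrier_mat)
  then show ?thesis
    by (simp add: act[OF V])
qed

section \<open>The graded trace\<close>

text \<open>In row \<open>i\<close> the sign \<open>(-1)^\<langle>g\<^sub>i + x, g\<^sub>i\<rangle>\<close> is split into \<open>(-1)^\<langle>g\<^sub>i, g\<^sub>i\<rangle>\<close> and
  \<open>(-1)^\<langle>x, g\<^sub>i\<rangle>\<close>. The second factor is absorbed by the twist, because a diagonal entry of
  a matrix of degree \<open>x\<close> has degree \<open>x\<close>, and the formula becomes additive in the matrix.\<close>

definition graded_trace :: "'a mat \<Rightarrow> 'a" where
  "graded_trace X = (\<Sum>i<N. bit_sign (deg i \<bullet> deg i) * twist (deg i) (X $$ (i, i)))"

lemma graded_trace_add:
  assumes "X \<in> carrier_mat N N" "Y \<in> carrier_mat N N"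
  shows "graded_trace (X + Y) = graded_trace X + graded_trace Y"
  using assms by (simp add: graded_trace_def twist_add distrib_left sum.distrib)

lemma graded_trace_scale:
  assumes "X \<in> carrier_mat N N"
  shows "graded_trace (map_mat (scale c) X) = scale c (graded_trace X)"
  using assms by (simp add: graded_trace_def twist_scale scale_sum_right scale_mult_right)

lemma graded_trace_homogeneous_sum:
  assumes "X \<in> carrier_mat N N" "x \<in> carrier_vec n" "\<And>i. i < N \<Longrightarrow> X $$ (i, i) \<in> A x"
  shows "graded_trace X = (\<Sum>i<N. bit_sign ((deg i + x) \<bullet> deg i) * X $$ (i, i))"
  unfolding graded_trace_def
proof (intro sum.cong refl)
  fix i assume "i \<in> {..<N}"
  then have i: "i < N" by simp
  have "(deg i + x) \<bullet> deg i = deg i \<bullet> deg i + x \<bullet> deg i"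
    using i assms(2) by (intro add_scalar_prod_distrib) auto
  then show "bit_sign (deg i \<bullet> deg i) * twist (deg i) (X $$ (i, i)) =
      bit_sign ((deg i + x) \<bullet> deg i) * X $$ (i, i)"
    by (simp only: twist_homogeneous[OF assms(3)[OF i] assms(2)] bit_sign_add mult.assoc)
qed

lemma homogeneous_diagonal:
  assumes "X \<in> homogeneous_mats n \<gamma> r A x" "x \<in> carrier_vec n" "i < N"
  shows "X $$ (i, i) \<in> A x"
proof -
  have "X $$ (i, i) \<in> A (deg i + deg i + x)"
    using assms by (simp add: homogeneous_mats_iff)
  with assms show ?thesis
    by (simp add: bit_vec_add_self[OF deg_carrier])
qed

lemma graded_trace_blocks:
  assumes "X \<in> homogeneous_mats n \<gamma> r A x" "x \<in> carrier_vec n"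
  shows "graded_trace X =
    (\<Sum>k<2 ^ n. bit_sign ((\<gamma> k + x) \<bullet> \<gamma> k) * mat_trace (block r X k k))"
proof -
  have "graded_trace X = (\<Sum>i<N. bit_sign ((deg i + x) \<bullet> deg i) * X $$ (i, i))"
    using assms homogeneous_diagonal
    by (intro graded_trace_homogeneous_sum) (auto simp: homogeneous_mats_iff)
  also have "\<dots> = (\<Sum>k<2 ^ n. \<Sum>i<r k. bit_sign ((\<gamma> k + x) \<bullet> \<gamma> k)
      * X $$ (sum r {..<k} + i, sum r {..<k} + i))"
    unfolding total_dim_def by (subst sum_blocks[symmetric]) (simp add: block_index_offset)
  finally show ?thesis
    by (simp add: mat_trace_def block_def sum_distrib_left)
qed

lemma graded_trace_weight_0:
  assumes "X \<in> homogeneous_mats n \<gamma> r A x" "x \<in> carrier_vec n"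
  shows "graded_trace X \<in> A x"
  unfolding graded_trace_def
proof (rule sum_in[OF assms(2)])
  fix i assume "i \<in> {..<N}"
  then have "X $$ (i, i) \<in> A x"
    using homogeneous_diagonal[OF assms] by simp
  then show "bit_sign (deg i \<bullet> deg i) * twist (deg i) (X $$ (i, i)) \<in> A x"
    unfolding twist_homogeneous[OF \<open>X $$ (i, i) \<in> A x\<close> assms(2)]
    by (intro bit_sign_in assms(2))
qed

text \<open>Row \<open>i\<close> of the matrix is multiplied by the twist of \<open>a\<close> by \<open>g\<^sub>i\<close>, which the second twist
  turns back into \<open>a\<close>.\<close>

lemma graded_trace_action: "graded_trace (mat_action n \<gamma> r A a X) = a * graded_trace X"
  by (simp add: graded_trace_def mat_action_index twist_mult sum_distrib_left
    bit_sign_left_commute[of a])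

text \<open>Both sides are sums over pairs \<open>(i, j)\<close> of the products of \<open>X\<^sub>i\<^sub>j\<close> and \<open>Y\<^sub>j\<^sub>i\<close>, in
  opposite orders. They agree term by term: after the two factors are commuted, the signs match by
  \<open>trace_sign_identity\<close>.\<close>

lemma graded_trace_mult_commute:
  assumes X: "X \<in> homogeneous_mats n \<gamma> r A x" and x: "x \<in> carrier_vec n"
    and Y: "Y \<in> homogeneous_mats n \<gamma> r A y" and y: "y \<in> carrier_vec n"
  shows "graded_trace (X * Y) = bit_sign (x \<bullet> y) * graded_trace (Y * X)"
proof -
  have car: "X \<in> carrier_mat N N" "Y \<in> carrier_mat N N"
    using assms by (auto simp: homogeneous_mats_iff)
  have Xin: "X $$ (i, j) \<in> A (deg i + deg j + x)" if "i < N" "j < N" for i j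
    using X x that by (simp add: homogeneous_mats_iff)
  have Yin: "Y $$ (i, j) \<in> A (deg i + deg j + y)" if "i < N" "j < N" for i j
    using Y y that by (simp add: homogeneous_mats_iff)
  have deg_prod: "(deg i + deg j + u) + (deg j + deg i + v) = u + v"
    if "i < N" "j < N" "u \<in> carrier_vec n" "v \<in> carrier_vec n" for i j u v
  proof -
    have [simp]: "dim_vec (deg i) = n" "dim_vec (deg j) = n" "dim_vec u = n" "dim_vec v = n"
      using that by (auto dest: deg_carrier)
    have "a + b + c + (b + a + d) = c + d" for a b c d :: bit
      by (cases a; cases b) auto
    then show ?thesis
      by (intro eq_vecI) auto
  qed
  have prod_entry: "(P * Q) $$ (i, i) = (\<Sum>j<N. P $$ (i, j) * Q $$ (j, i))"
    if "P \<in> carrier_mat N N" "Q \<in> carrier_mat N N" "i < N" for P Q :: "'a mat" and i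
    using that by (auto simp: scalar_prod_def lessThan_atLeast0)
  have XY: "X $$ (i, j) * Y $$ (j, i) \<in> A (x + y)" if "i < N" "j < N" for i j
    using mult_component[OF _ _ Xin Yin, of i j j i] that x y deg_prod by simp
  have YX: "Y $$ (j, i) * X $$ (i, j) \<in> A (x + y)" if "i < N" "j < N" for i j
    using mult_component[OF _ _ Yin Xin, of j i i j] that x y deg_prod
    by (simp add: comm_add_vec[of x n y])
  have "graded_trace (X * Y) =
      (\<Sum>i<N. \<Sum>j<N. bit_sign ((deg i + (x + y)) \<bullet> deg i) * (X $$ (i, j) * Y $$ (j, i)))"
    using car x y XY
    by (subst graded_trace_homogeneous_sum[of _ "x + y"])
      (auto simp: prod_entry sum_distrib_left simp del: index_mult_mat(1) intro!: sum_in)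
  also have "\<dots> = (\<Sum>i<N. \<Sum>j<N. bit_sign (x \<bullet> y)
      * (bit_sign ((deg j + (x + y)) \<bullet> deg j) * (Y $$ (j, i) * X $$ (i, j))))"
  proof (intro sum.cong refl)
    fix i j assume "i \<in> {..<N}" "j \<in> {..<N}"
    then have ij: "i < N" "j < N" by auto
    have "Y $$ (j, i) * X $$ (i, j) =
        bit_sign ((deg i + deg j + x) \<bullet> (deg j + deg i + y)) * (X $$ (i, j) * Y $$ (j, i))"
      using ij x y Xin Yin by (intro graded_commutative) auto
    then show "bit_sign ((deg i + (x + y)) \<bullet> deg i) * (X $$ (i, j) * Y $$ (j, i)) =
        bit_sign (x \<bullet> y) *
        (bit_sign ((deg j + (x + y)) \<bullet> deg j) * (Y $$ (j, i) * X $$ (i, j)))"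
      using trace_sign_identity[OF deg_carrier deg_carrier x y, OF ij]
      by (simp only: bit_sign_add mult.assoc bit_sign_self_left)
  qed
  also have "\<dots> = bit_sign (x \<bullet> y) * (\<Sum>j<N. \<Sum>i<N.
      bit_sign ((deg j + (x + y)) \<bullet> deg j) * (Y $$ (j, i) * X $$ (i, j)))"
    by (subst sum.swap) (simp add: sum_distrib_left)
  also have "(\<Sum>j<N. \<Sum>i<N.
      bit_sign ((deg j + (x + y)) \<bullet> deg j) * (Y $$ (j, i) * X $$ (i, j))) = graded_trace (Y * X)"
    using car x y YX
    by (subst graded_trace_homogeneous_sum[of _ "x + y"])
      (auto simp: prod_entry sum_distrib_left simp del: index_mult_mat(1) intro!: sum_in)
  finally show ?thesis .
qed

lemma graded_trace_bracket: "graded_trace (mat_bracket n \<gamma> r A X Y) = 0"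
proof -
  let ?P = "\<lambda>x. mat_component n \<gamma> r A x X" and ?Q = "\<lambda>y. mat_component n \<gamma> r A y Y"
  have "graded_trace (?P x * ?Q y - bit_sign (x \<bullet> y) \<cdot>\<^sub>m (?Q y * ?P x)) = 0"
    if xy: "x \<in> carrier_vec n" "y \<in> carrier_vec n" for x y
  proof -
    have "graded_trace (U - bit_sign b \<cdot>\<^sub>m V) = graded_trace U - bit_sign b * graded_trace V"
      if "U \<in> carrier_mat N N" "V \<in> carrier_mat N N" for U V b
      using that by (intro linear_diff_bit_sign graded_trace_add graded_trace_action)
    with xy show ?thesis
      by (simp add: mult_carrier_mat[of _ N N _ N] graded_trace_mult_commute[of _ x _ y]
        mat_component_homogeneous)
  qed
  then show ?thesis
    unfolding mat_bracket_def
    by (subst additive_mat_sum[where N = N])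
      (auto simp: graded_trace_add finite_carrier_vec_bit intro!: sum.neutral minus_carrier_mat
        smult_carrier_mat mult_carrier_mat[of _ N N _ N])
qed

section \<open>Uniqueness by matrix units\<close>

definition matrix_unit :: "nat \<Rightarrow> nat \<Rightarrow> 'a mat" where
  "matrix_unit i j = mat N N (\<lambda>(k, l). if k = i \<and> l = j then 1 else 0)"

lemma matrix_unit_homogeneous:
  assumes "i < N" "j < N"
  shows "matrix_unit i j \<in> homogeneous_mats n \<gamma> r A (deg i + deg j)"
proof -
  have "deg i + deg j + (deg i + deg j) = 0\<^sub>v n"
    using assms by (intro bit_vec_add_self) auto
  with assms show ?thesis
    by (auto simp: homogeneous_mats_iff matrix_unit_def zero_in one_in)
qed

lemma matrix_unit_carrier [simp]: "matrix_unit i j \<in> carrier_mat N N"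
  by (simp add: matrix_unit_def)

lemma matrix_unit_mult:
  assumes "j < N"
  shows "matrix_unit i j * matrix_unit k l = (if j = k then matrix_unit i l else 0\<^sub>m N N)"
proof (rule eq_matI)
  fix a b
  assume "a < dim_row (if j = k then matrix_unit i l else 0\<^sub>m N N)"
    "b < dim_col (if j = k then matrix_unit i l else 0\<^sub>m N N)"
  then have ab: "a < N" "b < N"
    by (auto simp: matrix_unit_def split: if_splits)
  then have "(matrix_unit i j * matrix_unit k l) $$ (a, b) =
      (\<Sum>c\<in>{0..<N}. (if a = i \<and> c = j then 1 else 0) * (if c = k \<and> b = l then 1 else 0))"
    by (simp add: matrix_unit_def scalar_prod_def)
  also have "\<dots> = (\<Sum>c\<in>{0..<N}. if c = j then (if a = i \<and> j = k \<and> b = l then 1 else 0) else 0)"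
    by (intro sum.cong) auto
  finally show "(matrix_unit i j * matrix_unit k l) $$ (a, b) =
      (if j = k then matrix_unit i l else 0\<^sub>m N N) $$ (a, b)"
    using ab assms by (simp add: matrix_unit_def)
qed (auto simp: matrix_unit_def)

text \<open>The action twists coefficients by the degree of the row, so the entry must be twisted once
  before it acts.\<close>

lemma matrix_unit_expansion:
  assumes "X \<in> carrier_mat N N"
  shows "X = mat_sum N (\<lambda>(i, j). mat_action n \<gamma> r A (twist (deg i) (X $$ (i, j))) (matrix_unit i j))
    ({..<N} \<times> {..<N})"
    (is "X = mat_sum N ?F ?S")
proof (rule eq_matI)
  fix a b assume "a < dim_row (mat_sum N ?F ?S)" "b < dim_col (mat_sum N ?F ?S)"
  then have ab: "a < N" "b < N" by auto
  then have "(\<Sum>p\<in>?S. ?F p $$ (a, b)) = (\<Sum>p\<in>?S. if p = (a, b) then X $$ (a, b) else 0)"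
    by (intro sum.cong) (auto simp: mat_action_index matrix_unit_def split: if_splits)
  with ab show "X $$ (a, b) = mat_sum N ?F ?S $$ (a, b)"
    by simp
qed (use assms in auto)

text \<open>The matrix units generate, and the brackets \<open>[E\<^sub>i\<^sub>j, E\<^sub>j\<^sub>j]\<close> and \<open>[E\<^sub>i\<^sub>j, E\<^sub>j\<^sub>i]\<close>,
  which \<open>f\<close> must kill, determine the values on them up to one scalar.\<close>

lemma graded_trace_unique:
  assumes hom: "graded_lie_algebra_hom scale n \<gamma> r A f" and lin: "algebra_linear n \<gamma> r A f"
  shows "\<exists>c\<in>A (0\<^sub>v n). \<forall>X\<in>carrier_mat N N. f X = c * graded_trace X"
proof -
  have add: "f (X + Y) = f X + f Y" if "X \<in> carrier_mat N N" "Y \<in> carrier_mat N N" for X Y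
    using lin that by (simp add: algebra_linear_def graded_mats_eq)
  have act: "f (mat_action n \<gamma> r A a X) = a * f X" if "X \<in> carrier_mat N N" for a X
    using lin that by (simp add: algebra_linear_def graded_mats_eq)
  have bracket: "f (mat_bracket n \<gamma> r A X Y) = 0"
    if "X \<in> carrier_mat N N" "Y \<in> carrier_mat N N" for X Y
    using hom that by (simp add: graded_lie_algebra_hom_def graded_mats_eq alg_bracket_eq_0)
  have off_diagonal: "f (matrix_unit i j) = 0" if ij: "i < N" "j < N" "i \<noteq> j" for i j
  proof -
    have "mat_bracket n \<gamma> r A (matrix_unit i j) (matrix_unit j j) =
        matrix_unit i j - bit_sign ((deg i + deg j) \<bullet> (deg j + deg j)) \<cdot>\<^sub>m 0\<^sub>m N N"
      using ij by (subst mat_bracket_homogeneous[OF matrix_unit_homogeneous _ matrix_unit_homogeneous])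
        (auto simp: matrix_unit_mult)
    also have "\<dots> = matrix_unit i j"
      by (intro eq_matI) (auto simp: matrix_unit_def)
    finally show ?thesis
      using bracket[of "matrix_unit i j" "matrix_unit j j"] by simp
  qed
  have diagonal: "bit_sign (deg i \<bullet> deg i) * f (matrix_unit i i) =
      bit_sign (deg j \<bullet> deg j) * f (matrix_unit j j)" if ij: "i < N" "j < N" for i j
  proof -
    \<comment> \<open>Both matrix units have degree \<open>g\<^sub>i + g\<^sub>j\<close>; this is the exponent of the sign in their bracket.\<close>
    have norm: "(deg i + deg j) \<bullet> (deg j + deg i) = deg i \<bullet> deg i + deg j \<bullet> deg j"
      unfolding comm_add_vec[OF deg_carrier deg_carrier, OF ij(2,1)]
      using ij by (intro scalar_prod_self_add) auto
    let ?s = "bit_sign (deg i \<bullet> deg i + deg j \<bullet> deg j) :: 'a"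
    have "mat_bracket n \<gamma> r A (matrix_unit i j) (matrix_unit j i) =
        matrix_unit i i - ?s \<cdot>\<^sub>m matrix_unit j j"
      using ij norm
      by (subst mat_bracket_homogeneous[OF matrix_unit_homogeneous _ matrix_unit_homogeneous])
        (auto simp: matrix_unit_mult)
    then have "f (matrix_unit i i - ?s \<cdot>\<^sub>m matrix_unit j j) = 0"
      using bracket[of "matrix_unit i j" "matrix_unit j i"] by simp
    then have "f (matrix_unit i i) = ?s * f (matrix_unit j j)"
      using linear_diff_bit_sign[of f "matrix_unit i i" "matrix_unit j j", OF add act] by simp
    then show ?thesis
      by (simp only: bit_sign_add mult.assoc bit_sign_self_left)
  qed
  \<comment> \<open>The common value is read off from row 0; without rows there is only the zero map.\<close>
  obtain c where c: "c \<in> A (0\<^sub>v n)"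
    and units: "\<And>i. i < N \<Longrightarrow> f (matrix_unit i i) = bit_sign (deg i \<bullet> deg i) * c"
  proof (cases "N = 0")
    case True
    with zero_in that[of 0] show ?thesis by simp
  next
    case False
    show ?thesis
    proof (rule that[of "bit_sign (deg 0 \<bullet> deg 0) * f (matrix_unit 0 0)"])
      have "f (matrix_unit 0 0) \<in> A (deg 0 + deg 0)"
        using hom False matrix_unit_homogeneous[of 0 0]
        by (simp add: graded_lie_algebra_hom_def)
      with False show "bit_sign (deg 0 \<bullet> deg 0) * f (matrix_unit 0 0) \<in> A (0\<^sub>v n)"
        using bit_vec_add_self[OF deg_carrier, of 0] by (auto intro: bit_sign_in)
      show "f (matrix_unit i i) = bit_sign (deg i \<bullet> deg i) *
          (bit_sign (deg 0 \<bullet> deg 0) * f (matrix_unit 0 0))" if "i < N" for i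
        using diagonal[OF that, of 0] False by (metis bit_sign_self_left gr0I)
    qed
  qed
  have "f X = c * graded_trace X" if X: "X \<in> carrier_mat N N" for X
  proof -
    have "f X = (\<Sum>i<N. \<Sum>j<N. twist (deg i) (X $$ (i, j)) * f (matrix_unit i j))"
      by (subst matrix_unit_expansion[OF X], subst additive_mat_sum[where N = N])
        (auto simp: add act sum.cartesian_product intro!: sum.cong)
    also have "\<dots> = (\<Sum>i<N. \<Sum>j<N. if j = i then
        twist (deg i) (X $$ (i, i)) * (bit_sign (deg i \<bullet> deg i) * c) else 0)"
      by (intro sum.cong) (auto simp: off_diagonal units)
    also have "\<dots> = graded_trace X * c"
      by (simp add: graded_trace_def sum_distrib_right mult.assoc
        bit_sign_left_commute[of "twist _ _"])
    finally show ?thesis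
      by (simp add: degree_0_central[OF c])
  qed
  with c show ?thesis
    by blast
qed

end

section \<open>Existence and uniqueness of the graded trace\<close>

theorem theorem1:
  fixes scale :: "'k::field_char_0 \<Rightarrow> 'a::{ring, monoid_mult} \<Rightarrow> 'a"
    and n :: nat and A :: "bit vec \<Rightarrow> 'a set"
    and \<gamma> :: "nat \<Rightarrow> bit vec" and r :: "nat \<Rightarrow> nat"
  assumes "graded_commutative_algebra scale n A"
    and "even_first_enumeration n \<gamma>"
  shows "\<exists>\<Gamma>tr :: 'a mat \<Rightarrow> 'a.
    graded_lie_algebra_hom scale n \<gamma> r A \<Gamma>tr \<and> algebra_linear n \<gamma> r A \<Gamma>tr \<and>
    (\<forall>x\<in>carrier_vec n. \<forall>X\<in>homogeneous_mats n \<gamma> r A x.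
       \<Gamma>tr X = (\<Sum>k<2 ^ n. bit_sign ((\<gamma> k + x) \<bullet> \<gamma> k) * mat_trace (block r X k k))) \<and>
    (\<forall>f. graded_lie_algebra_hom scale n \<gamma> r A f \<and> algebra_linear n \<gamma> r A f \<longrightarrow>
       (\<exists>c\<in>A (0\<^sub>v n). \<forall>X\<in>graded_mats n \<gamma> r A. f X = c * \<Gamma>tr X))"
proof -
  interpret graded_commutative_algebra scale n A
    by fact
  interpret graded_block_matrices scale n A \<gamma> r
    by unfold_locales
      (use assms(2) in \<open>auto simp: even_first_enumeration_def bij_betw_def\<close>)
  have "graded_lie_algebra_hom scale n \<gamma> r A graded_trace"
    by (simp add: graded_lie_algebra_hom_def graded_mats_eq graded_trace_add graded_trace_scale
      graded_trace_weight_0 graded_trace_bracket alg_bracket_eq_0)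
  moreover have "algebra_linear n \<gamma> r A graded_trace"
    by (simp add: algebra_linear_def graded_mats_eq graded_trace_add graded_trace_action)
  ultimately show ?thesis
    using graded_trace_blocks graded_trace_unique
    by (intro exI[of _ graded_trace]) (auto simp: graded_mats_eq)
qed

end
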